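(* Let $\Lambda$ be a lattice (free abelian group of finite rank). (i) $\Sigma(S)=\Sigma(S+\sigma)$ for any semilattice $S$ in $\Lambda$ and any $\sigma\in S$. (ii) The saturation number is a similarity invariant: if $S$ and $S'$ are similar semilattices in $\Lambda$, then $\mathfrak s(S)=\mathfrak s(S')$.
   Context: A semilattice in $\Lambda$ is a subset $S\subset\Lambda$ with $0\in S$, $S-2S\subset S$ (i.e. $\sigma-2\rho\in S$ for $\sigma,\rho\in S$), and $S$ generates $\Lambda$. If $S$ is a semilattice in $\Lambda$ and $\sigma\in S$, then $S+\sigma$ is also a semilattice in $\Lambda$. Two semilattices $S,S'$ in $\Lambda$ are similar if $\varphi(S+\sigma)=S'$ for some $\varphi\in\operatorname{Aut}\Lambda$ and some $\sigma\in S$. An element $\gamma\in S$ is saturated if $\gamma+\sigma\in S$ for all $\sigma\in S$. $\Sigma(S)$ denotes the set of saturated elements of $S$; it is a subgroup of $\Lambda$ containing $2\Lambda$. The saturation number $\mathfrak s(S)$ is defined by $|\Lambda/\Sigma(S)|=2^{\mathfrak s(S)}$. *)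

theory Defs
  imports "HOL-Algebra.Algebra"
begin

text \<open>
  Groups are written multiplicatively, as in HOL-Algebra: for a lattice \<open>L\<close> the product
  \<open>x \<otimes>\<^bsub>L\<^esub> y\<close> is the sum of \<open>x\<close> and \<open>y\<close>, the unit \<open>\<one>\<^bsub>L\<^esub>\<close> is zero, \<open>x [^]\<^bsub>L\<^esub> (2::nat)\<close> is
  twice \<open>x\<close>, and the translate of a subset \<open>S\<close> by \<open>x\<close> is the coset \<open>S #>\<^bsub>L\<^esub> x\<close>.
\<close>

locale Z_lattice = comm_group L for L (structure) +
  assumes free_finite_rank: "\<exists>n::nat. L \<cong> free_Abelian_group {..<n}"

definition semilattice_in :: "('a, 'b) monoid_scheme \<Rightarrow> 'a set \<Rightarrow> bool" where
  "semilattice_in L S \<longleftrightarrow>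
     S \<subseteq> carrier L \<and>
     \<one>\<^bsub>L\<^esub> \<in> S \<and>
     (\<forall>\<sigma>\<in>S. \<forall>\<rho>\<in>S. \<sigma> \<otimes>\<^bsub>L\<^esub> inv\<^bsub>L\<^esub> (\<rho> [^]\<^bsub>L\<^esub> (2::nat)) \<in> S) \<and>
     generate L S = carrier L"

text \<open>Intended for two semilattices \<open>S\<close> and \<open>S'\<close> in \<open>L\<close>; \<open>iso L L\<close> is the automorphism group.\<close>

definition similar_semilattices :: "('a, 'b) monoid_scheme \<Rightarrow> 'a set \<Rightarrow> 'a set \<Rightarrow> bool" where
  "similar_semilattices L S S' \<longleftrightarrow>
     (\<exists>\<phi>\<in>iso L L. \<exists>\<sigma>\<in>S. \<phi> ` (S #>\<^bsub>L\<^esub> \<sigma>) = S')"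

definition saturated_elements :: "('a, 'b) monoid_scheme \<Rightarrow> 'a set \<Rightarrow> 'a set" where
  "saturated_elements L S = {\<gamma> \<in> S. \<forall>\<sigma>\<in>S. \<gamma> \<otimes>\<^bsub>L\<^esub> \<sigma> \<in> S}"

text \<open>That the exponent exists is lemma \<open>order_Mod_saturated_elements\<close> below.\<close>

definition saturation_number :: "('a, 'b) monoid_scheme \<Rightarrow> 'a set \<Rightarrow> nat" where
  "saturation_number L S = (THE s. order (L Mod saturated_elements L S) = 2 ^ s)"

lemma (in comm_group) card_generate_exponent_2:
  assumes "finite B" "B \<subseteq> carrier G" "\<And>x. x \<in> carrier G \<Longrightarrow> x \<otimes> x = \<one>"
  shows "\<exists>k::nat. card (generate G B) = 2 ^ k"
proof -
  have "finite (generate G B) \<and> (\<exists>k::nat. card (generate G B) = 2 ^ k)"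
    using assms(1,2)
  proof (induction B)
    case empty
    have "generate G {} = {\<one>}" by (rule generate_empty)
    then show ?case by (auto intro: exI[of _ 0])
  next
    case (insert b B)
    define H where "H = generate G B"
    have H: "subgroup H G" unfolding H_def
      using insert.prems by (intro generate_is_subgroup) auto
    have fin: "finite H" and "\<exists>k::nat. card H = 2 ^ k"
      using insert by (auto simp: H_def)
    then obtain k where k: "card H = 2 ^ k" by auto
    have b: "b \<in> carrier G" using insert.prems by auto
    have Hc: "H \<subseteq> carrier G" using H subgroup.subset by auto
    have HB: "B \<subseteq> H" unfolding H_def by (auto intro: generate.incl)
    show ?case
    proof (cases "b \<in> H")
      case True
      have "generate G (insert b B) = H"
        using True HB H generate_subgroup_incl[of "insert b B" H] mono_generate[of B "insert b B"]
        unfolding H_def by blast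
      then show ?thesis using fin k by auto
    next
      case False
      have ix: "inv x = x" if "x \<in> carrier G" for x
        using assms(3)[OF that] that by (simp add: inv_equality)
      define K where "K = H \<union> (H #> b)"
      have mm: "x \<otimes> y \<in> H" if "x \<in> H" "y \<in> H" for x y
        using H that by (simp add: subgroup.m_closed)
      have K_b: "h \<otimes> b \<in> K" if "h \<in> H" for h
        using that by (auto simp: K_def r_coset_def)
      have K: "subgroup K G"
      proof (rule subgroupI)
        show "K \<subseteq> carrier G" using Hc b by (auto simp: K_def r_coset_def)
        then show "inv a \<in> K" if "a \<in> K" for a using that ix by (metis subsetD)
        show "K \<noteq> {}" using subgroup.one_closed[OF H] by (auto simp: K_def)
        fix x y assume "x \<in> K" "y \<in> K"
        then have xs: "x \<in> H \<or> (\<exists>h\<in>H. x = h \<otimes> b)" and ys: "y \<in> H \<or> (\<exists>h\<in>H. y = h \<otimes> b)"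
          by (auto simp: K_def r_coset_def)
        have e1: "h \<otimes> b \<otimes> h' = h \<otimes> h' \<otimes> b" if "h \<in> H" "h' \<in> H" for h h'
          using that Hc b by (simp add: m_ac subset_iff)
        have e2: "h \<otimes> (h' \<otimes> b) = h \<otimes> h' \<otimes> b" if "h \<in> H" "h' \<in> H" for h h'
          using that Hc b by (simp add: m_ac subset_iff)
        have e3: "h \<otimes> b \<otimes> (h' \<otimes> b) = h \<otimes> h'" if "h \<in> H" "h' \<in> H" for h h'
        proof -
          have "h \<otimes> b \<otimes> (h' \<otimes> b) = h \<otimes> h' \<otimes> (b \<otimes> b)"
            using that Hc b by (simp add: m_ac subset_iff)
          then show ?thesis using assms(3)[OF b] that Hc by (simp add: subset_iff)
        qed
        have HK: "h \<in> K" if "h \<in> H" for h using that by (simp add: K_def)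
        from xs ys show "x \<otimes> y \<in> K"
          using mm K_b HK e1 e2 e3 by (elim disjE bexE) simp_all
      qed
      have bK: "b \<in> K"
        using K_b[OF subgroup.one_closed[OF H]] b by simp
      have "generate G (insert b B) = K"
      proof
        show "generate G (insert b B) \<subseteq> K"
          using K bK HB by (intro generate_subgroup_incl) (auto simp: K_def)
        have sub: "subgroup (generate G (insert b B)) G"
          using insert.prems by (intro generate_is_subgroup) auto
        have "H \<subseteq> generate G (insert b B)" unfolding H_def by (intro mono_generate) auto
        moreover have "b \<in> generate G (insert b B)" by (auto intro: generate.incl)
        ultimately show "K \<subseteq> generate G (insert b B)"
          using subgroup.m_closed[OF sub] by (auto simp: K_def r_coset_def)
      qed
      moreover have "H \<inter> (H #> b) = {}"
      proof (rule ccontr)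
        assume "H \<inter> (H #> b) \<noteq> {}"
        then obtain h where h: "h \<in> H" "h \<otimes> b \<in> H" by (auto simp: r_coset_def)
        have "inv h \<otimes> (h \<otimes> b) \<in> H" using h mm subgroup.m_inv_closed[OF H] by blast
        moreover have "inv h \<otimes> (h \<otimes> b) = b"
          using h Hc b by (simp add: subset_iff inv_solve_left')
        ultimately show False using False by simp
      qed
      moreover have "card (H #> b) = card H" "finite (H #> b)"
      proof -
        have "H #> b = (\<lambda>h. h \<otimes> b) ` H" by (auto simp: r_coset_def)
        moreover have "inj_on (\<lambda>h. h \<otimes> b) H" using inj_on_g[OF Hc b] .
        ultimately show "card (H #> b) = card H" "finite (H #> b)"
          using fin by (auto simp: card_image)
      qed
      ultimately have "finite (generate G (insert b B))" "card (generate G (insert b B)) = 2 ^ Suc k"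
        using fin k by (auto simp: K_def card_Un_disjoint)
      then show ?thesis by blast
    qed
  qed
  then show ?thesis ..
qed

context Z_lattice
begin

lemma finitely_generated:
  obtains B where "finite B" "B \<subseteq> carrier L" "generate L B = carrier L"
proof -
  obtain n :: nat where "L \<cong> free_Abelian_group {..<n}" using free_finite_rank by blast
  then have "free_Abelian_group {..<n} \<cong> L" by (rule iso_sym)
  then obtain h where h: "h \<in> iso (free_Abelian_group {..<n}) L" by (auto simp: is_iso_def)
  define F where "F = free_Abelian_group {..<n}"
  have F: "group F" by (simp add: F_def)
  interpret group_hom F L h
    using h F is_group by (simp add: group_hom_def group_hom_axioms_def F_def iso_def)
  define A where "A = frag_of ` {..<n}"
  have A: "A \<subseteq> carrier F" by (auto simp: A_def F_def)
  have sub: "subgroup (generate F A) F" using A by (rule G.generate_is_subgroup)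
  have "x \<in> generate F A" if "Poly_Mapping.keys x \<subseteq> {..<n}" for x
  proof -
    have "x \<in> carrier F \<and> x \<in> generate F A"
      using that
    proof (induction x rule: frag_induction)
      case zero
      then show ?case
        using subgroup.one_closed[OF sub] by (simp add: F_def)
    next
      case (one x)
      then show ?case by (auto simp: A_def F_def intro!: generate.incl)
    next
      case (diff a b)
      then have "a \<otimes>\<^bsub>F\<^esub> inv\<^bsub>F\<^esub> b \<in> generate F A"
        using subgroup.m_closed[OF sub] subgroup.m_inv_closed[OF sub] by blast
      moreover have "a \<otimes>\<^bsub>F\<^esub> inv\<^bsub>F\<^esub> b = a - b"
        using diff by (simp add: F_def)
      ultimately show ?case using subgroup.subset[OF sub] by auto
    qed
    then show ?thesis ..
  qed
  then have gen: "generate F A = carrier F"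
    using subgroup.subset[OF sub] by (auto simp: F_def)
  have "generate L (h ` A) = h ` carrier F"
    using generate_img[OF A] gen by simp
  also have "\<dots> = carrier L" using h by (auto simp: Group.iso_iff F_def)
  finally have "generate L (h ` A) = carrier L" .
  moreover have "finite (h ` A)" by (simp add: A_def)
  moreover have "h ` A \<subseteq> carrier L" using A by auto
  ultimately show ?thesis using that by blast
qed

lemma subgroup_saturated_elements:
  assumes S: "semilattice_in L S"
  shows "subgroup (saturated_elements L S) L"
    and "\<And>x. x \<in> carrier L \<Longrightarrow> x \<otimes> x \<in> saturated_elements L S"
proof -
  have Sc: "x \<in> carrier L" if "x \<in> S" for x
    using S that by (auto simp: semilattice_in_def)
  have S1: "\<one> \<in> S" using S by (simp add: semilattice_in_def)
  have Sd: "x \<otimes> inv (y \<otimes> y) \<in> S" if "x \<in> S" "y \<in> S" for x y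
    using S that Sc by (auto simp: semilattice_in_def numeral_2_eq_2)
  have Si: "inv x \<in> S" if "x \<in> S" for x
  proof -
    have "x \<otimes> inv (x \<otimes> x) = inv x"
      using Sc[OF that] by (simp add: inv_mult_group m_assoc[symmetric])
    then show ?thesis using Sd[OF that that] by simp
  qed
  have Sp: "x \<otimes> (y \<otimes> y) \<in> S" if "x \<in> S" "y \<in> S" for x y
    using Sd[OF that(1) Si[OF that(2)]] Sc[OF that(2)] by (simp add: inv_mult_group)
  show sub: "subgroup (saturated_elements L S) L"
  proof (rule subgroupI)
    show "saturated_elements L S \<subseteq> carrier L" using Sc by (auto simp: saturated_elements_def)
    show "saturated_elements L S \<noteq> {}" using S1 Sc by (auto simp: saturated_elements_def)
  next
    fix a assume a: "a \<in> saturated_elements L S"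
    have "inv a \<otimes> \<sigma> \<in> S" if "\<sigma> \<in> S" for \<sigma>
    proof -
      have "inv (a \<otimes> inv \<sigma>) \<in> S"
        using a that Si by (auto simp: saturated_elements_def)
      moreover have "inv (a \<otimes> inv \<sigma>) = inv a \<otimes> \<sigma>"
        using a that Sc by (auto simp: saturated_elements_def inv_mult)
      ultimately show ?thesis by simp
    qed
    then show "inv a \<in> saturated_elements L S"
      using a Si by (auto simp: saturated_elements_def)
  next
    fix a b assume "a \<in> saturated_elements L S" "b \<in> saturated_elements L S"
    then show "a \<otimes> b \<in> saturated_elements L S"
      using Sc by (auto simp: saturated_elements_def m_assoc)
  qed
  have SS: "x \<otimes> x \<in> saturated_elements L S" if "x \<in> S" for x
  proof -
    have "x \<otimes> x \<in> S" using Sp[OF S1 that] Sc[OF that] by simp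
    moreover have "x \<otimes> x \<otimes> y \<in> S" if "y \<in> S" for y
      using Sp[OF that \<open>x \<in> S\<close>] Sc \<open>x \<in> S\<close> that by (simp add: m_comm)
    ultimately show ?thesis by (simp add: saturated_elements_def)
  qed
  have "x \<otimes> x \<in> saturated_elements L S" if "x \<in> generate L S" for x
    using that
  proof (induction x rule: generate.induct)
    case one
    then show ?case using SS[OF S1] by simp
  next
    case (incl h)
    then show ?case by (rule SS)
  next
    case (inv h)
    then show ?case by (intro SS Si)
  next
    case (eng a b)
    have "a \<in> carrier L" "b \<in> carrier L"
      using eng.hyps S by (auto simp: semilattice_in_def)
    then have "a \<otimes> b \<otimes> (a \<otimes> b) = (a \<otimes> a) \<otimes> (b \<otimes> b)" by (simp add: m_ac)
    then show ?case using eng.IH subgroup.m_closed[OF sub] by simp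
  qed
  then show "x \<otimes> x \<in> saturated_elements L S" if "x \<in> carrier L" for x
    using that S by (simp add: semilattice_in_def)
qed

lemma order_Mod_saturated_elements:
  assumes S: "semilattice_in L S"
  shows "order (L Mod saturated_elements L S) = 2 ^ saturation_number L S"
proof -
  define H where "H = saturated_elements L S"
  have H: "subgroup H L" "\<And>x. x \<in> carrier L \<Longrightarrow> x \<otimes> x \<in> H"
    unfolding H_def using subgroup_saturated_elements[OF S] by auto
  have N: "H \<lhd> L" using H(1) by (rule subgroup_imp_normal)
  interpret Q: comm_group "L Mod H" using H(1) by (rule abelian_FactGroup)
  interpret h: group_hom L "L Mod H" "\<lambda>a. H #> a"
    using normal.r_coset_hom_Mod[OF N]
    by (simp add: group_hom_def group_hom_axioms_def is_group Q.is_group)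
  have img: "(\<lambda>a. H #> a) ` carrier L = carrier (L Mod H)"
    by (auto simp: FactGroup_def RCOSETS_def)
  obtain B where B: "finite B" "B \<subseteq> carrier L" "generate L B = carrier L"
    by (rule finitely_generated)
  have "generate (L Mod H) ((\<lambda>a. H #> a) ` B) = carrier (L Mod H)"
    using h.generate_img[OF B(2)] B(3) img by simp
  moreover have "x \<otimes>\<^bsub>L Mod H\<^esub> x = \<one>\<^bsub>L Mod H\<^esub>" if x: "x \<in> carrier (L Mod H)" for x
  proof -
    obtain a where a: "a \<in> carrier L" "x = H #> a"
      using x by (auto simp: FactGroup_def RCOSETS_def)
    have "x \<otimes>\<^bsub>L Mod H\<^esub> x = H #> (a \<otimes> a)"
      unfolding a(2) by (rule h.hom_mult[OF a(1) a(1), symmetric])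
    also have "\<dots> = H" by (rule coset_join2[OF _ H(1) H(2)[OF a(1)]]) (use a(1) in simp)
    finally show ?thesis by (simp add: FactGroup_def)
  qed
  moreover have "finite ((\<lambda>a. H #> a) ` B)" "(\<lambda>a. H #> a) ` B \<subseteq> carrier (L Mod H)"
    using B(1,2) img by auto
  ultimately obtain k :: nat where k: "order (L Mod H) = 2 ^ k"
    using Q.card_generate_exponent_2[of "(\<lambda>a. H #> a) ` B"]
    unfolding order_def by metis
  show ?thesis
    unfolding saturation_number_def H_def[symmetric]
    by (rule theI[of _ k]) (use k in auto)
qed

end

end

theory Submission
  imports Defs
begin

text \<open>
  The set \<open>\<Sigma>(S)\<close> is the stabilizer of \<open>S\<close> under translation, \<open>{\<gamma>. \<gamma> + S \<subseteq> S}\<close>: the extra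
  requirement \<open>\<gamma> \<in> S\<close> is automatic because \<open>0 \<in> S\<close> (lemma \<open>saturated_elements_eq_stabilizer\<close>).
  Written this way, \<open>\<Sigma>(S)\<close> does not change when \<open>S\<close> is translated, provided that the translate
  still contains \<open>0\<close>. For \<open>S + \<sigma>\<close> with \<open>\<sigma> \<in> S\<close> it does, since \<open>-\<sigma> = \<sigma> - 2\<sigma> \<in> S\<close>. This is the
  first claim.

  Saturation is defined by the group operation alone, so an automorphism \<open>\<phi>\<close> maps \<open>\<Sigma>(T)\<close> onto
  \<open>\<Sigma>(\<phi>(T))\<close>. If \<open>\<phi>(S + \<sigma>) = S'\<close>, then \<open>\<Sigma>(S') = \<phi>(\<Sigma>(S + \<sigma>)) = \<phi>(\<Sigma>(S))\<close> by the first claim,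
  and \<open>\<phi>\<close> carries the cosets of \<open>\<Sigma>(S)\<close> bijectively to those of \<open>\<Sigma>(S')\<close>. The two quotients
  therefore have the same order, hence the same saturation number.
\<close>

lemma (in group) saturated_elements_eq_stabilizer:
  assumes "T \<subseteq> carrier G" "\<one> \<in> T"
  shows "saturated_elements G T = {\<gamma> \<in> carrier G. \<forall>\<tau>\<in>T. \<gamma> \<otimes> \<tau> \<in> T}"
proof -
  have "\<gamma> \<in> T" if "\<gamma> \<in> carrier G" "\<forall>\<tau>\<in>T. \<gamma> \<otimes> \<tau> \<in> T" for \<gamma>
    using that assms(2) r_one by metis
  then show ?thesis
    using assms(1) by (auto simp: saturated_elements_def)
qed

lemma (in group) inv_in_semilattice:
  assumes "semilattice_in G S" "\<sigma> \<in> S"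
  shows "inv \<sigma> \<in> S"
proof -
  have \<sigma>: "\<sigma> \<in> carrier G" using assms by (auto simp: semilattice_in_def)
  have "\<sigma> \<otimes> inv (\<sigma> [^] (2::nat)) = inv \<sigma>"
    using \<sigma> by (simp add: numeral_2_eq_2 inv_mult_group m_assoc[symmetric])
  then show ?thesis using assms by (metis semilattice_in_def)
qed

text \<open>
  Cancelling \<open>\<sigma>\<close> in \<open>\<gamma> + (\<tau> + \<sigma>) \<in> S + \<sigma>\<close> leaves \<open>\<gamma> + \<tau> \<in> S\<close>, so \<open>S + \<sigma>\<close> and \<open>S\<close> have the
  same stabilizer. Both stabilizers are sets of saturated elements because \<open>S + \<sigma>\<close> contains
  \<open>-\<sigma> + \<sigma> = 0\<close>.
\<close>

lemma (in group) saturated_elements_translate: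
  assumes S: "semilattice_in G S" and \<sigma>: "\<sigma> \<in> S"
  shows "saturated_elements G (S #> \<sigma>) = saturated_elements G S"
proof -
  have Sc: "S \<subseteq> carrier G" and S1: "\<one> \<in> S" using S by (auto simp: semilattice_in_def)
  have \<sigma>c: "\<sigma> \<in> carrier G" using Sc \<sigma> by blast
  have "inv \<sigma> \<otimes> \<sigma> \<in> S #> \<sigma>"
    using inv_in_semilattice[OF S \<sigma>] by (auto simp: r_coset_def)
  then have one: "\<one> \<in> S #> \<sigma>" using \<sigma>c by simp
  have mem: "x \<otimes> \<sigma> \<in> S #> \<sigma> \<longleftrightarrow> x \<in> S" if "x \<in> carrier G" for x
    using that Sc \<sigma>c by (auto simp: r_coset_def subset_iff)
  have "(\<forall>\<tau>\<in>S #> \<sigma>. \<gamma> \<otimes> \<tau> \<in> S #> \<sigma>) \<longleftrightarrow> (\<forall>\<tau>\<in>S. \<gamma> \<otimes> \<tau> \<in> S)" if \<gamma>: "\<gamma> \<in> carrier G" for \<gamma>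
  proof -
    have "(\<forall>\<tau>\<in>S #> \<sigma>. \<gamma> \<otimes> \<tau> \<in> S #> \<sigma>) \<longleftrightarrow> (\<forall>\<tau>\<in>S. \<gamma> \<otimes> (\<tau> \<otimes> \<sigma>) \<in> S #> \<sigma>)"
      by (auto simp: r_coset_def)
    also have "\<dots> \<longleftrightarrow> (\<forall>\<tau>\<in>S. \<gamma> \<otimes> \<tau> \<otimes> \<sigma> \<in> S #> \<sigma>)"
      using \<gamma> Sc \<sigma>c by (intro ball_cong) (auto simp: m_assoc subset_iff)
    also have "\<dots> \<longleftrightarrow> (\<forall>\<tau>\<in>S. \<gamma> \<otimes> \<tau> \<in> S)"
      using \<gamma> Sc by (intro ball_cong refl mem) auto
    finally show ?thesis .
  qed
  then show ?thesis
    using saturated_elements_eq_stabilizer[OF Sc S1]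
      saturated_elements_eq_stabilizer[OF r_coset_subset_G[OF Sc \<sigma>c] one] by auto
qed

lemma (in group) saturated_elements_image:
  assumes \<phi>: "\<phi> \<in> hom G K" "inj_on \<phi> (carrier G)" and T: "T \<subseteq> carrier G"
  shows "saturated_elements K (\<phi> ` T) = \<phi> ` saturated_elements G T"
proof -
  have "\<phi> c \<otimes>\<^bsub>K\<^esub> \<phi> t \<in> \<phi> ` T \<longleftrightarrow> c \<otimes> t \<in> T" if "c \<in> T" "t \<in> T" for c t
  proof -
    have "\<phi> c \<otimes>\<^bsub>K\<^esub> \<phi> t = \<phi> (c \<otimes> t)" using hom_mult[OF \<phi>(1)] that T by (metis subsetD)
    then show ?thesis
      using inj_on_image_mem_iff[OF \<phi>(2) _ T, of "c \<otimes> t"] that T by auto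
  qed
  then show ?thesis by (auto simp: saturated_elements_def)
qed

text \<open>
  Since \<open>\<phi>(H + a) = \<phi>(H) + \<phi>(a)\<close> and \<open>\<phi>\<close> is surjective, taking images under \<open>\<phi>\<close> maps the cosets
  of \<open>H\<close> onto the cosets of \<open>\<phi>(H)\<close>; it is injective on subsets of the carrier because \<open>\<phi>\<close> is.
\<close>

lemma (in group) order_Mod_iso_image:
  assumes \<phi>: "\<phi> \<in> iso G K" and H: "H \<subseteq> carrier G"
  shows "order (K Mod (\<phi> ` H)) = order (G Mod H)"
proof -
  have hom: "\<phi> \<in> hom G K" and inj: "inj_on \<phi> (carrier G)" and surj: "\<phi> ` carrier G = carrier K"
    using \<phi> by (auto simp: iso_def bij_betw_def)
  have coset: "\<phi> ` H #>\<^bsub>K\<^esub> \<phi> a = \<phi> ` (H #> a)" if "a \<in> carrier G" for a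
  proof -
    have "\<phi> h \<otimes>\<^bsub>K\<^esub> \<phi> a = \<phi> (h \<otimes> a)" if "h \<in> H" for h
      using hom_mult[OF hom] that H \<open>a \<in> carrier G\<close> by (metis subsetD)
    then show ?thesis by (auto simp: r_coset_def)
  qed
  have "rcosets\<^bsub>K\<^esub> (\<phi> ` H) = (`) \<phi> ` (rcosets H)"
    unfolding RCOSETS_def surj[symmetric] using coset by auto
  moreover have "inj_on ((`) \<phi>) (rcosets H)"
  proof (rule inj_on_subset[OF inj_on_image_Pow[OF inj]])
    show "rcosets H \<subseteq> Pow (carrier G)"
      using r_coset_subset_G[OF H] by (auto simp: RCOSETS_def)
  qed
  ultimately show ?thesis by (simp add: order_def FactGroup_def card_image)
qed

theorem lemma4p3:
  fixes L :: "('a, 'b) monoid_scheme"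
  assumes "Z_lattice L"
  shows "(\<forall>S \<sigma>. semilattice_in L S \<and> \<sigma> \<in> S \<longrightarrow>
            saturated_elements L S = saturated_elements L (S #>\<^bsub>L\<^esub> \<sigma>)) \<and>
         (\<forall>S S'. semilattice_in L S \<and> semilattice_in L S' \<and> similar_semilattices L S S' \<longrightarrow>
            saturation_number L S = saturation_number L S')"
proof -
  interpret Z_lattice L by fact
  have "saturation_number L S = saturation_number L S'"
    if S: "semilattice_in L S" and sim: "similar_semilattices L S S'" for S S'
  proof -
    obtain \<phi> \<sigma> where \<phi>: "\<phi> \<in> iso L L" and \<sigma>: "\<sigma> \<in> S" and S': "S' = \<phi> ` (S #>\<^bsub>L\<^esub> \<sigma>)"
      using sim by (auto simp: similar_semilattices_def)
    have Sc: "S \<subseteq> carrier L" using S by (simp add: semilattice_in_def)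
    have "saturated_elements L S' = \<phi> ` saturated_elements L (S #>\<^bsub>L\<^esub> \<sigma>)"
      unfolding S' using \<phi> Sc \<sigma>
      by (intro saturated_elements_image r_coset_subset_G) (auto simp: iso_def bij_betw_def)
    also have "\<dots> = \<phi> ` saturated_elements L S"
      by (simp add: saturated_elements_translate[OF S \<sigma>])
    finally have "order (L Mod saturated_elements L S') = order (L Mod saturated_elements L S)"
      using order_Mod_iso_image[OF \<phi>] Sc by (simp add: saturated_elements_def subset_iff)
    then show ?thesis by (simp add: saturation_number_def)
  qed
  then show ?thesis by (simp add: saturated_elements_translate)
qed

end
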